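(* Let $W$ be the Weyl group of a finite crystallographic root system, $w\in W$, and $I\subseteq J(w)$. If $w$ is $I$-spherical (i.e. has an $I$-witness), then there exists an $I$-witness $R$ of $w$ of the form $R=R'R''$ (concatenation) where $R'$ is a reduced expression of $w_0(I)$ and $R''$ is a reduced expression of $w_0(I)w$.
   Context: $W$ has simple generators $s_1,\dots,s_r$ indexed by the nodes $[r]=\{1,\dots,r\}$ of the Dynkin diagram $\mathcal G$; $\ell$ is Coxeter length, and $J(w)=\{j\in[r]:\ell(s_jw)<\ell(w)\}$ is the set of left descents. For $I\subseteq[r]$, $w_0(I)$ is the longest element of the parabolic subgroup generated by $\{s_i:i\in I\}$; the induced subdiagram $\mathcal G_I$ decomposes into connected components $\mathcal C^{(1)},\dots,\mathcal C^{(m)}$, and $w_0^{(z)}$ is the longest element of the parabolic subgroup generated by $\{s_j: j\in\mathcal C^{(z)}\}$. An $I$-witness of $w$ is a reduced expression $R=s_{i_1}\cdots s_{i_{\ell(w)}}$ of $w$ such that $\#\{t: i_t=j\}\le 1$ for all $j\in[r]\setminus I$, and $\#\{t: i_t\in\mathcal C^{(z)}\}\le \ell(w_0^{(z)})+\#\mathrm{vertices}(\mathcal C^{(z)})$ for $1\le z\le m$. $w$ is $I$-spherical if it has an $I$-witness. *)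

theory Defs
  imports
    "HOL-Analysis.Analysis"
    "HOL-Algebra.Generated_Groups"
    "HOL-Algebra.Bij"
begin

definition reflection :: "'a::euclidean_space \<Rightarrow> 'a \<Rightarrow> 'a" where
  "reflection a v = v - (2 * (v \<bullet> a) / (a \<bullet> a)) *\<^sub>R a"

text \<open>As in Humphreys, \<^emph>\<open>Reflection Groups and Coxeter Groups\<close> (1.2, 2.9): roots are not required
  to span the ambient space, so the empty root system, with trivial Weyl group, is included.\<close>

definition crystallographic_root_system :: "'a::euclidean_space set \<Rightarrow> bool" where
  "crystallographic_root_system \<Phi> \<longleftrightarrow>
     finite \<Phi> \<and> 0 \<notin> \<Phi> \<and>
     (\<forall>a\<in>\<Phi>. \<Phi> \<inter> span {a} = {a, - a}) \<and>
     (\<forall>a\<in>\<Phi>. reflection a ` \<Phi> = \<Phi>) \<and>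
     (\<forall>a\<in>\<Phi>. \<forall>b\<in>\<Phi>. 2 * (a \<bullet> b) / (b \<bullet> b) \<in> \<int>)"

text \<open>The simple roots are \<open>\<alpha> 1, \<dots>, \<alpha> r\<close>; values of \<open>\<alpha>\<close> outside \<open>{1..r}\<close> are irrelevant.\<close>

definition simple_system :: "'a::euclidean_space set \<Rightarrow> nat \<Rightarrow> (nat \<Rightarrow> 'a) \<Rightarrow> bool" where
  "simple_system \<Phi> r \<alpha> \<longleftrightarrow>
     inj_on \<alpha> {1..r} \<and> \<alpha> ` {1..r} \<subseteq> \<Phi> \<and> independent (\<alpha> ` {1..r}) \<and>
     (\<forall>b\<in>\<Phi>. \<exists>c :: nat \<Rightarrow> real.
        b = (\<Sum>i\<in>{1..r}. c i *\<^sub>R \<alpha> i) \<and>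
        ((\<forall>i\<in>{1..r}. 0 \<le> c i) \<or> (\<forall>i\<in>{1..r}. c i \<le> 0)))"

definition weyl_group :: "'a::euclidean_space set \<Rightarrow> ('a \<Rightarrow> 'a) set" where
  "weyl_group \<Phi> = generate (BijGroup UNIV) (reflection ` \<Phi>)"

definition simple_refl :: "(nat \<Rightarrow> 'a::euclidean_space) \<Rightarrow> nat \<Rightarrow> 'a \<Rightarrow> 'a" where
  "simple_refl \<alpha> i = reflection (\<alpha> i)"

definition parabolic :: "(nat \<Rightarrow> 'a::euclidean_space) \<Rightarrow> nat set \<Rightarrow> ('a \<Rightarrow> 'a) set" where
  "parabolic \<alpha> I = generate (BijGroup UNIV) (simple_refl \<alpha> ` I)"

text \<open>Words \<open>s\<^bsub>i\<^sub>1\<^esub> \<cdots> s\<^bsub>i\<^sub>k\<^esub>\<close> in the simple generators are encoded as lists \<open>[i\<^sub>1, \<dots>, i\<^sub>k]\<close> of indices.\<close>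

definition word_val :: "(nat \<Rightarrow> 'a::euclidean_space) \<Rightarrow> nat list \<Rightarrow> 'a \<Rightarrow> 'a" where
  "word_val \<alpha> R = foldr (\<lambda>i f. simple_refl \<alpha> i \<circ> f) R id"

definition cox_length :: "nat \<Rightarrow> (nat \<Rightarrow> 'a::euclidean_space) \<Rightarrow> ('a \<Rightarrow> 'a) \<Rightarrow> nat" where
  "cox_length r \<alpha> w =
     (LEAST n. \<exists>R. set R \<subseteq> {1..r} \<and> length R = n \<and> word_val \<alpha> R = w)"

definition reduced_expr ::
    "nat \<Rightarrow> (nat \<Rightarrow> 'a::euclidean_space) \<Rightarrow> nat list \<Rightarrow> ('a \<Rightarrow> 'a) \<Rightarrow> bool" where
  "reduced_expr r \<alpha> R w \<longleftrightarrow>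
     set R \<subseteq> {1..r} \<and> word_val \<alpha> R = w \<and> length R = cox_length r \<alpha> w"

definition left_descents ::
    "nat \<Rightarrow> (nat \<Rightarrow> 'a::euclidean_space) \<Rightarrow> ('a \<Rightarrow> 'a) \<Rightarrow> nat set" where
  "left_descents r \<alpha> w =
     {j \<in> {1..r}. cox_length r \<alpha> (simple_refl \<alpha> j \<circ> w) < cox_length r \<alpha> w}"

definition longest_elt :: "nat \<Rightarrow> (nat \<Rightarrow> 'a::euclidean_space) \<Rightarrow> nat set \<Rightarrow> 'a \<Rightarrow> 'a" where
  "longest_elt r \<alpha> I =
     (THE w. w \<in> parabolic \<alpha> I \<and> (\<forall>v\<in>parabolic \<alpha> I. cox_length r \<alpha> v \<le> cox_length r \<alpha> w))"

text \<open>Adjacency in the Dynkin diagram; bond multiplicities and arrows do not affect connectedness.\<close>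

definition dynkin_edges :: "nat \<Rightarrow> (nat \<Rightarrow> 'a::euclidean_space) \<Rightarrow> (nat \<times> nat) set" where
  "dynkin_edges r \<alpha> = {(i, j). i \<in> {1..r} \<and> j \<in> {1..r} \<and> i \<noteq> j \<and> \<alpha> i \<bullet> \<alpha> j \<noteq> 0}"

text \<open>Vertex sets of the connected components of the subdiagram induced on \<open>I\<close>.\<close>

definition dynkin_components ::
    "nat \<Rightarrow> (nat \<Rightarrow> 'a::euclidean_space) \<Rightarrow> nat set \<Rightarrow> nat set set" where
  "dynkin_components r \<alpha> I = I // (dynkin_edges r \<alpha> \<inter> I \<times> I)\<^sup>*"

definition witness ::
    "nat \<Rightarrow> (nat \<Rightarrow> 'a::euclidean_space) \<Rightarrow> nat set \<Rightarrow> ('a \<Rightarrow> 'a) \<Rightarrow> nat list \<Rightarrow> bool" where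
  "witness r \<alpha> I w R \<longleftrightarrow>
     reduced_expr r \<alpha> R w \<and>
     (\<forall>j\<in>{1..r} - I. count_list R j \<le> 1) \<and>
     (\<forall>C\<in>dynkin_components r \<alpha> I.
        length (filter (\<lambda>i. i \<in> C) R) \<le> cox_length r \<alpha> (longest_elt r \<alpha> C) + card C)"

definition spherical ::
    "nat \<Rightarrow> (nat \<Rightarrow> 'a::euclidean_space) \<Rightarrow> nat set \<Rightarrow> ('a \<Rightarrow> 'a) \<Rightarrow> bool" where
  "spherical r \<alpha> I w \<longleftrightarrow> (\<exists>R. witness r \<alpha> I w R)"

end

theory Submission
  imports Defs
begin

text \<open>
  Prepend the letters of a reduced word of \<open>w\<^sub>0(I)\<close> to a witness one at a time, last letter first,
  using the exchange condition. Each exchange prepends some \<open>j \<in> I\<close> and deletes a letter \<open>k\<close> preceded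
  by a prefix \<open>A\<close> with \<open>A \<alpha>\<^sub>k = \<alpha>\<^sub>j\<close>; the letter never comes from the part already built, since that part
  stays reduced after prepending \<open>j\<close>. A letter \<open>p \<notin> I\<close> occurs at most once in \<open>A\<close>, and it is the only
  one that can change the \<open>\<alpha>\<^sub>p\<close>-coordinate, which is \<open>0\<close> both for \<open>\<alpha>\<^sub>k\<close> and for \<open>\<alpha>\<^sub>j\<close>; hence it acts
  trivially. So \<open>\<alpha>\<^sub>j\<close> is obtained from \<open>\<alpha>\<^sub>k\<close> by letters of \<open>I\<close> only, which forces \<open>k\<close> and \<open>j\<close> into the
  same component of \<open>I\<close>. Thus every exchange preserves all the counts in the definition of a witness.
\<close>

section \<open>Reflections and words\<close>

lemma linear_reflection: "linear (reflection a)"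
  by (rule linearI)
     (simp_all add: reflection_def algebra_simps inner_add_left add_divide_distrib)

lemma reflection_involution [simp]: "reflection a (reflection a v) = v"
  by (cases "a = 0") (simp_all add: reflection_def inner_diff_left)

lemma reflection_self: "reflection a a = - a"
  by (cases "a = 0") (simp_all add: reflection_def scaleR_2)

lemma inner_reflection: "reflection a x \<bullet> reflection a y = x \<bullet> y"
  by (cases "a = 0") (simp_all add: reflection_def algebra_simps inner_commute)

lemma word_val_Nil [simp]: "word_val \<alpha> [] = id"
  by (simp add: word_val_def)

lemma word_val_Cons [simp]: "word_val \<alpha> (i # R) = simple_refl \<alpha> i \<circ> word_val \<alpha> R"
  by (simp add: word_val_def)

lemma word_val_append [simp]: "word_val \<alpha> (R @ S) = word_val \<alpha> R \<circ> word_val \<alpha> S"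
  by (induction R) (simp_all add: comp_assoc)

lemma simple_refl_involution [simp]: "simple_refl \<alpha> i (simple_refl \<alpha> i v) = v"
  by (simp add: simple_refl_def)

lemma simple_refl_comp_involution [simp]: "simple_refl \<alpha> i \<circ> (simple_refl \<alpha> i \<circ> f) = f"
  by (simp add: fun_eq_iff)

lemma linear_word_val: "linear (word_val \<alpha> R)"
proof (induction R)
  case (Cons i R)
  then show ?case
    unfolding word_val_Cons simple_refl_def by (rule linear_compose[OF _ linear_reflection])
qed (simp add: linear_ident)

lemma inner_word_val: "word_val \<alpha> R x \<bullet> word_val \<alpha> R y = x \<bullet> y"
  by (induction R) (simp_all add: simple_refl_def inner_reflection)

lemma word_val_rev_left [simp]: "word_val \<alpha> (rev R) (word_val \<alpha> R v) = v"
  by (induction R) simp_all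

lemma word_val_rev_right [simp]: "word_val \<alpha> R (word_val \<alpha> (rev R) v) = v"
  using word_val_rev_left[of \<alpha> "rev R"] by simp

text \<open>A reversed word represents the inverse map, which depends only on the map and not on the
  word chosen for it.\<close>

lemma word_val_rev_cong:
  assumes "word_val \<alpha> R = word_val \<alpha> S"
  shows "word_val \<alpha> (rev R) = word_val \<alpha> (rev S)"
  by (metis assms ext word_val_rev_left word_val_rev_right)

text \<open>Words act linearly and isometrically, so conjugating a reflection by a word gives the
  reflection in the image of its root.\<close>

lemma word_val_reflection:
  "word_val \<alpha> R (reflection a v) = reflection (word_val \<alpha> R a) (word_val \<alpha> R v)"
proof -
  interpret linear "word_val \<alpha> R" by (rule linear_word_val)
  show ?thesis by (simp add: reflection_def diff scale inner_word_val)
qed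

text \<open>Conjugation gives s_j A = A s_k. Read from right to left, this trades the inner letter
  \<open>k\<close> for a leading \<open>j\<close>, keeping the value and the length of the
  word.\<close>

lemma word_val_exchange:
  assumes "word_val \<alpha> A (\<alpha> k) = \<alpha> j"
  shows "word_val \<alpha> (j # A @ B) = word_val \<alpha> (A @ k # B)"
  using assms by (simp add: fun_eq_iff simple_refl_def word_val_reflection)

section \<open>Coxeter length and reduced words\<close>

lemma cox_length_le:
  assumes "set R \<subseteq> {1..r}"
  shows "cox_length r \<alpha> (word_val \<alpha> R) \<le> length R"
  unfolding cox_length_def using assms by (intro Least_le) blast

lemma reduced_expr_exists:
  assumes "set R \<subseteq> {1..r}"
  shows "\<exists>S. reduced_expr r \<alpha> S (word_val \<alpha> R)"
proof -
  have "\<exists>S. set S \<subseteq> {1..r} \<and> length S = cox_length r \<alpha> (word_val \<alpha> R)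
          \<and> word_val \<alpha> S = word_val \<alpha> R"
    unfolding cox_length_def by (rule LeastI_ex) (use assms in blast)
  then show ?thesis
    unfolding reduced_expr_def by blast
qed

text \<open>A shorter word for the suffix \<open>B\<close> would shorten the whole word.\<close>

lemma reduced_expr_appendD:
  assumes "reduced_expr r \<alpha> (A @ B) w"
  shows "reduced_expr r \<alpha> B (word_val \<alpha> B)"
proof -
  have sub: "set A \<subseteq> {1..r}" "set B \<subseteq> {1..r}"
    and w: "w = word_val \<alpha> A \<circ> word_val \<alpha> B" and len: "length A + length B = cox_length r \<alpha> w"
    using assms by (auto simp: reduced_expr_def)
  obtain S where S: "reduced_expr r \<alpha> S (word_val \<alpha> B)"
    using reduced_expr_exists sub(2) by blast
  then have "cox_length r \<alpha> w \<le> length (A @ S)"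
    using cox_length_le[of "A @ S" r \<alpha>] sub w by (simp add: reduced_expr_def)
  then show ?thesis
    using S sub len cox_length_le[of B r \<alpha>] by (simp add: reduced_expr_def)
qed

section \<open>Parabolic subgroups as sets of words\<close>

lemma word_val_Bij: "word_val \<alpha> R \<in> Bij UNIV"
proof -
  have "bij (word_val \<alpha> R)"
    by (rule o_bij[where g = "word_val \<alpha> (rev R)"]) (simp_all add: fun_eq_iff)
  then show ?thesis
    by (simp add: Bij_def extensional_def)
qed

lemma simple_refl_Bij: "simple_refl \<alpha> i \<in> Bij UNIV"
  using word_val_Bij[of \<alpha> "[i]"] by simp

lemma inv_simple_refl: "m_inv (BijGroup UNIV) (simple_refl \<alpha> i) = simple_refl \<alpha> i"
proof -
  have "inv_into UNIV (simple_refl \<alpha> i) = simple_refl \<alpha> i"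
    by (rule inv_unique_comp) (simp_all add: fun_eq_iff)
  then show ?thesis
    by (simp add: inv_BijGroup simple_refl_Bij restrict_def)
qed

lemma mult_BijGroup_UNIV:
  assumes "f \<in> Bij UNIV" "g \<in> Bij UNIV"
  shows "f \<otimes>\<^bsub>BijGroup UNIV\<^esub> g = f \<circ> g"
  using assms by (simp add: BijGroup_def compose_def fun_eq_iff)

text \<open>Each generator is its own inverse, so products of generators exhaust the generated
  subgroup. From here on, group elements are handled through words only.\<close>

lemma parabolic_eq: "parabolic \<alpha> I = word_val \<alpha> ` lists I"
proof (intro equalityI subsetI)
  fix w assume "w \<in> parabolic \<alpha> I"
  then show "w \<in> word_val \<alpha> ` lists I"
    unfolding parabolic_def
  proof (induction rule: generate.induct)
    case one
    have "\<one>\<^bsub>BijGroup UNIV\<^esub> = word_val \<alpha> []"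
      by (simp add: BijGroup_def fun_eq_iff)
    then show ?case by blast
  next
    case (incl h)
    then obtain i where "i \<in> I" "h = simple_refl \<alpha> i" by blast
    then have "h = word_val \<alpha> [i]" "[i] \<in> lists I" by simp_all
    then show ?case by blast
  next
    case (inv h)
    then obtain i where "i \<in> I" "h = simple_refl \<alpha> i" by blast
    then have "inv\<^bsub>BijGroup UNIV\<^esub> h = word_val \<alpha> [i]" "[i] \<in> lists I"
      by (simp_all add: inv_simple_refl)
    then show ?case by blast
  next
    case (eng f g)
    then obtain R S where "f = word_val \<alpha> R" "g = word_val \<alpha> S" "R @ S \<in> lists I" by auto
    then show ?case
      by (metis image_eqI mult_BijGroup_UNIV word_val_Bij word_val_append)
  qed
next
  fix w assume "w \<in> word_val \<alpha> ` lists I"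
  then obtain R where "R \<in> lists I" and w: "w = word_val \<alpha> R" by blast
  from this(1) have "word_val \<alpha> R \<in> generate (BijGroup UNIV) (simple_refl \<alpha> ` I)"
  proof (induction R)
    case Nil
    have "word_val \<alpha> [] = \<one>\<^bsub>BijGroup UNIV\<^esub>"
      by (simp add: BijGroup_def fun_eq_iff)
    then show ?case by (metis generate.one)
  next
    case (Cons i R)
    have "simple_refl \<alpha> i \<otimes>\<^bsub>BijGroup UNIV\<^esub> word_val \<alpha> R
        \<in> generate (BijGroup UNIV) (simple_refl \<alpha> ` I)"
      using Cons.hyps Cons.IH by (intro generate.eng[OF generate.incl]) simp_all
    then show ?case
      by (simp add: mult_BijGroup_UNIV simple_refl_Bij word_val_Bij comp_def)
  qed
  then show "w \<in> parabolic \<alpha> I"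
    by (simp add: parabolic_def w)
qed

section \<open>The exchange condition\<close>

locale root_basis =
  fixes \<Phi> :: "'a::euclidean_space set" and r :: nat and \<alpha> :: "nat \<Rightarrow> 'a"
  assumes root_system: "crystallographic_root_system \<Phi>"
    and simple: "simple_system \<Phi> r \<alpha>"
begin

text \<open>The functional dual to \<alpha>_k. Since the simple roots need not span the space, it is
  one chosen linear extension; on their span, which contains all roots, it is determined.\<close>

definition coord :: "nat \<Rightarrow> 'a \<Rightarrow> real" where
  "coord k = (SOME f. linear f \<and> (\<forall>i\<in>{1..r}. f (\<alpha> i) = (if i = k then 1 else 0)))"

lemma
  shows linear_coord: "linear (coord k)"
    and coord_simple: "i \<in> {1..r} \<Longrightarrow> coord k (\<alpha> i) = (if i = k then 1 else 0)"
proof -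
  have inj: "inj_on \<alpha> {1..r}" and ind: "independent (\<alpha> ` {1..r})"
    using simple by (auto simp: simple_system_def)
  \<comment> \<open>The values are prescribed on vectors, so \<open>inv_into\<close> recovers the
    index of a simple root; injectivity of \<alpha> makes this legitimate.\<close>
  obtain f :: "'a \<Rightarrow> real" where "linear f"
    and f: "\<forall>x\<in>\<alpha> ` {1..r}. f x = (if inv_into {1..r} \<alpha> x = k then 1 else 0)"
    using linear_independent_extend[OF ind,
        where f = "\<lambda>x. if inv_into {1..r} \<alpha> x = k then 1 else (0::real)"] by auto
  then have "\<exists>f. linear f \<and> (\<forall>i\<in>{1..r}. f (\<alpha> i) = (if i = k then 1 else (0::real)))"
    using inj by (intro exI[of _ f]) (simp add: inv_into_f_f)
  then have *: "linear (coord k) \<and> (\<forall>i\<in>{1..r}. coord k (\<alpha> i) = (if i = k then 1 else 0))"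
    unfolding coord_def by (rule someI_ex)
  show "linear (coord k)" using * by blast
  show "coord k (\<alpha> i) = (if i = k then 1 else 0)" if "i \<in> {1..r}" using * that by blast
qed

lemma coord_simple_refl:
  assumes "i \<in> {1..r}" "i \<noteq> k"
  shows "coord k (simple_refl \<alpha> i v) = coord k v"
proof -
  interpret linear "coord k" by (rule linear_coord)
  show ?thesis
    using assms by (simp add: simple_refl_def reflection_def diff scale coord_simple)
qed

text \<open>The reflection moves \<open>v\<close> by a multiple of \<alpha>_i, and coordinate
  \<open>i\<close> reads off that multiple.\<close>

lemma simple_refl_fixes:
  assumes "i \<in> {1..r}" "coord i (simple_refl \<alpha> i v) = coord i v"
  shows "simple_refl \<alpha> i v = v"
proof -
  interpret linear "coord i" by (rule linear_coord)
  show ?thesis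
    using assms by (simp add: simple_refl_def reflection_def diff scale coord_simple)
qed

lemma coord_word_val:
  assumes "set A \<subseteq> {1..r}" "k \<notin> set A"
  shows "coord k (word_val \<alpha> A v) = coord k v"
  using assms by (induction A) (auto simp: coord_simple_refl)

lemma simple_root: "i \<in> {1..r} \<Longrightarrow> \<alpha> i \<in> \<Phi>"
  using simple by (auto simp: simple_system_def)

lemma simple_refl_root:
  assumes "i \<in> {1..r}" "b \<in> \<Phi>"
  shows "simple_refl \<alpha> i b \<in> \<Phi>"
  using root_system simple_root[OF assms(1)] assms(2)
  by (auto simp: crystallographic_root_system_def simple_refl_def)

lemma word_val_root:
  assumes "set R \<subseteq> {1..r}" "b \<in> \<Phi>"
  shows "word_val \<alpha> R b \<in> \<Phi>"
  using assms by (induction R) (auto simp: simple_refl_root)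

text \<open>Applying \<open>coord k\<close> to the expansion provided by the simple system isolates
  its \<open>k\<close>-th coefficient, so the coordinates inherit the common sign.\<close>

lemma root_expansion:
  assumes "b \<in> \<Phi>"
  shows "b = (\<Sum>i\<in>{1..r}. coord i b *\<^sub>R \<alpha> i)"
    and "(\<forall>i\<in>{1..r}. 0 \<le> coord i b) \<or> (\<forall>i\<in>{1..r}. coord i b \<le> 0)"
proof -
  obtain c where b: "b = (\<Sum>i\<in>{1..r}. c i *\<^sub>R \<alpha> i)"
    and c: "(\<forall>i\<in>{1..r}. 0 \<le> c i) \<or> (\<forall>i\<in>{1..r}. c i \<le> 0)"
    using simple assms unfolding simple_system_def by blast
  have "coord k b = c k" if "k \<in> {1..r}" for k
  proof -
    interpret linear "coord k" by (rule linear_coord)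
    have "coord k b = (\<Sum>i\<in>{1..r}. c i * coord k (\<alpha> i))"
      unfolding b by (simp add: sum scale)
    also have "\<dots> = (\<Sum>i\<in>{1..r}. if i = k then c i else 0)"
      by (rule sum.cong) (simp_all add: coord_simple)
    finally show ?thesis using that by simp
  qed
  then show "b = (\<Sum>i\<in>{1..r}. coord i b *\<^sub>R \<alpha> i)"
    and "(\<forall>i\<in>{1..r}. 0 \<le> coord i b) \<or> (\<forall>i\<in>{1..r}. coord i b \<le> 0)"
    using b c by simp_all
qed

section \<open>Positive roots and the sign criterion for length\<close>

definition pos :: "'a \<Rightarrow> bool" where
  "pos b \<longleftrightarrow> b \<in> \<Phi> \<and> (\<forall>i\<in>{1..r}. 0 \<le> coord i b)"

lemma simple_pos: "i \<in> {1..r} \<Longrightarrow> pos (\<alpha> i)"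
  by (simp add: pos_def simple_root coord_simple)

lemma root_nonzero: "b \<in> \<Phi> \<Longrightarrow> b \<noteq> 0"
  using root_system by (auto simp: crystallographic_root_system_def)

lemma pos_minus:
  assumes "pos b"
  shows "\<not> pos (- b)"
proof
  assume neg: "pos (- b)"
  have "coord i b = 0" if "i \<in> {1..r}" for i
    using assms neg that linear_neg[OF linear_coord, of i b] by (force simp: pos_def)
  then have "b = 0"
    using root_expansion(1)[of b] assms by (simp add: pos_def)
  then show False
    using assms root_nonzero by (auto simp: pos_def)
qed

text \<open>Only coordinate \<open>i\<close> changes. If the image is not positive, every other
  coordinate of \<open>b\<close> is both nonnegative and nonpositive, so \<open>b\<close> is a root
  on the line of \<alpha>_i, hence \<alpha>_i or its negative, and positivity decides.\<close>

lemma pos_simple_refl: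
  assumes "pos b" "i \<in> {1..r}" "\<not> pos (simple_refl \<alpha> i b)"
  shows "b = \<alpha> i"
proof -
  have root: "b \<in> \<Phi>" "simple_refl \<alpha> i b \<in> \<Phi>"
    using assms simple_refl_root by (auto simp: pos_def)
  then have nonpos: "\<forall>k\<in>{1..r}. coord k (simple_refl \<alpha> i b) \<le> 0"
    using assms(3) root_expansion(2) unfolding pos_def by blast
  have zero: "coord k b = 0" if "k \<in> {1..r}" "k \<noteq> i" for k
    using assms(1) that nonpos coord_simple_refl[OF assms(2), of k b]
    by (force simp: pos_def)
  have "b = (\<Sum>k\<in>{1..r}. coord k b *\<^sub>R \<alpha> k)"
    by (rule root_expansion(1)[OF root(1)])
  also have "\<dots> = (\<Sum>k\<in>{i}. coord k b *\<^sub>R \<alpha> k)"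
    using assms(2) zero by (intro sum.mono_neutral_right) auto
  finally have "b \<in> span {\<alpha> i}"
    by (metis (no_types, lifting) empty_iff finite.emptyI insertI1 span_base span_scale
        sum.empty sum.insert add.right_neutral)
  then have "b = \<alpha> i \<or> b = - \<alpha> i"
    using root_system root(1) simple_root[OF assms(2)]
    unfolding crystallographic_root_system_def by blast
  then show ?thesis
    using assms(1) pos_minus simple_pos[OF assms(2)] by blast
qed

text \<open>Apply the letters of \<open>R\<close> to \<open>b\<close> one after another, first
  letter first. At the letter \<open>k\<close> where positivity is first lost, the current root must
  be \<alpha>_k; undoing the earlier letters \<open>A\<close> takes it back to
  \<open>b\<close>.\<close>

lemma sign_change:
  assumes "set R \<subseteq> {1..r}" "pos b" "\<not> pos (word_val \<alpha> (rev R) b)"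
  shows "\<exists>A k B. R = A @ k # B \<and> word_val \<alpha> A (\<alpha> k) = b"
  using assms
proof (induction R arbitrary: b)
  case (Cons i R)
  show ?case
  proof (cases "pos (simple_refl \<alpha> i b)")
    case True
    then obtain A k B where "R = A @ k # B" "word_val \<alpha> A (\<alpha> k) = simple_refl \<alpha> i b"
      using Cons.IH[of "simple_refl \<alpha> i b"] Cons.prems by auto
    then show ?thesis
      by (intro exI[of _ "i # A"] exI[of _ k] exI[of _ B]) simp
  next
    case False
    then have "b = \<alpha> i"
      using Cons.prems by (intro pos_simple_refl) auto
    then show ?thesis
      by (intro exI[of _ "[]"] exI[of _ i] exI[of _ R]) simp
  qed
qed simp

lemma cox_length_simple_refl_less:
  assumes "set R \<subseteq> {1..r}" "j \<in> {1..r}" "\<not> pos (word_val \<alpha> (rev R) (\<alpha> j))"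
  shows "cox_length r \<alpha> (simple_refl \<alpha> j \<circ> word_val \<alpha> R) < cox_length r \<alpha> (word_val \<alpha> R)"
proof -
  \<comment> \<open>\<open>R\<close> itself need not be reduced. A reduced word \<open>S\<close> of
    the same element has the same inverse, so the sign hypothesis carries over, and deleting a
    letter of \<open>S\<close> then lowers the length.\<close>
  obtain S where S: "reduced_expr r \<alpha> S (word_val \<alpha> R)"
    using reduced_expr_exists assms(1) by blast
  then have sub: "set S \<subseteq> {1..r}" and eq: "word_val \<alpha> S = word_val \<alpha> R"
    by (simp_all add: reduced_expr_def)
  then obtain A k B where AB: "S = A @ k # B" "word_val \<alpha> A (\<alpha> k) = \<alpha> j"
    using sign_change[of S "\<alpha> j"] assms simple_pos word_val_rev_cong[OF eq] by auto
  have "word_val \<alpha> R = simple_refl \<alpha> j \<circ> word_val \<alpha> (A @ B)"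
    using word_val_exchange[OF AB(2), of B] eq AB(1) by simp
  then have "simple_refl \<alpha> j \<circ> word_val \<alpha> R = word_val \<alpha> (A @ B)"
    by simp
  moreover have "cox_length r \<alpha> (word_val \<alpha> (A @ B)) \<le> length (A @ B)"
    using sub AB(1) by (intro cox_length_le) auto
  moreover have "length S = cox_length r \<alpha> (word_val \<alpha> R)"
    using S by (simp add: reduced_expr_def)
  ultimately show ?thesis
    using AB(1) by simp
qed

text \<open>For the forward direction, \<open>cox_length_simple_refl_less\<close> is applied to
  \<open>j # R\<close>, whose inverse sends \<alpha>_j to the negative of the root tested for
  \<open>R\<close>. The weak inequality is the form that maximality of an element supplies; equality
  of lengths is thereby excluded.\<close>

lemma cox_length_simple_refl_iff:
  assumes "set R \<subseteq> {1..r}" "j \<in> {1..r}"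
  shows "cox_length r \<alpha> (simple_refl \<alpha> j \<circ> word_val \<alpha> R) \<le> cox_length r \<alpha> (word_val \<alpha> R)
    \<longleftrightarrow> \<not> pos (word_val \<alpha> (rev R) (\<alpha> j))"
proof
  assume le: "cox_length r \<alpha> (simple_refl \<alpha> j \<circ> word_val \<alpha> R) \<le> cox_length r \<alpha> (word_val \<alpha> R)"
  show "\<not> pos (word_val \<alpha> (rev R) (\<alpha> j))"
  proof
    assume p: "pos (word_val \<alpha> (rev R) (\<alpha> j))"
    have "word_val \<alpha> (rev (j # R)) (\<alpha> j) = - word_val \<alpha> (rev R) (\<alpha> j)"
      by (simp add: simple_refl_def reflection_self linear_neg[OF linear_word_val])
    then have "\<not> pos (word_val \<alpha> (rev (j # R)) (\<alpha> j))"
      using pos_minus[OF p] by simp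
    then show False
      using cox_length_simple_refl_less[of "j # R" j] assms le by simp
  qed
qed (use cox_length_simple_refl_less assms in fastforce)

section \<open>Exchanges in reduced words\<close>

lemma exchange:
  assumes "reduced_expr r \<alpha> R w" "j \<in> {1..r}"
    and "cox_length r \<alpha> (simple_refl \<alpha> j \<circ> w) \<le> cox_length r \<alpha> w"
  obtains A k B where "R = A @ k # B" "word_val \<alpha> A (\<alpha> k) = \<alpha> j"
proof -
  have "set R \<subseteq> {1..r}" "w = word_val \<alpha> R"
    using assms(1) by (auto simp: reduced_expr_def)
  then show ?thesis
    using sign_change[of R "\<alpha> j"] cox_length_simple_refl_iff[of R j] assms simple_pos that
    by blast
qed

lemma reduced_expr_exchange:
  assumes "reduced_expr r \<alpha> (A @ k # B) w" "j \<in> {1..r}" "word_val \<alpha> A (\<alpha> k) = \<alpha> j"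
  shows "reduced_expr r \<alpha> (j # A @ B) w"
  using assms word_val_exchange[OF assms(3), of B] by (simp add: reduced_expr_def)

text \<open>Build the word from its last letter. Prepending \<open>j\<close> either gives a reduced
  word or, by exchange, amounts to deleting a letter; neither introduces letters outside
  \<open>I\<close>. So the length in the whole group is attained by words in
  \<open>I\<close>.\<close>

lemma reduced_expr_in_parabolic:
  assumes "I \<subseteq> {1..r}" "S \<in> lists I"
  shows "\<exists>T\<in>lists I. reduced_expr r \<alpha> T (word_val \<alpha> S)"
  using assms(2)
proof (induction S)
  case Nil
  have "cox_length r \<alpha> (word_val \<alpha> []) \<le> length ([] :: nat list)"
    by (rule cox_length_le) simp
  then have "reduced_expr r \<alpha> [] (word_val \<alpha> [])"
    by (simp add: reduced_expr_def)
  then show ?case by blast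
next
  case (Cons j S)
  then obtain T where T: "T \<in> lists I" "reduced_expr r \<alpha> T (word_val \<alpha> S)" by auto
  have j: "j \<in> I" "j \<in> {1..r}" using Cons assms(1) by auto
  obtain U where U: "reduced_expr r \<alpha> U (word_val \<alpha> (j # S))"
    using reduced_expr_exists[of "j # S" r \<alpha>] Cons.hyps assms(1) j by auto
  have TS: "set T \<subseteq> {1..r}" "word_val \<alpha> T = word_val \<alpha> S"
    "length T = cox_length r \<alpha> (word_val \<alpha> S)"
    using T(2) by (auto simp: reduced_expr_def)
  have "cox_length r \<alpha> (word_val \<alpha> (j # T)) \<le> length (j # T)"
    by (rule cox_length_le) (use j TS in auto)
  then have le: "cox_length r \<alpha> (word_val \<alpha> (j # S)) \<le> Suc (length T)"
    by (simp add: TS)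
  show ?case
  proof (cases "cox_length r \<alpha> (word_val \<alpha> (j # S)) \<le> cox_length r \<alpha> (word_val \<alpha> S)")
    case False
    then have "reduced_expr r \<alpha> (j # T) (word_val \<alpha> (j # S))"
      using le TS j by (simp add: reduced_expr_def)
    then show ?thesis using T(1) j by (intro bexI[of _ "j # T"]) (simp_all add: comp_def)
  next
    case True
    then obtain A k B where AB: "T = A @ k # B" "word_val \<alpha> A (\<alpha> k) = \<alpha> j"
      using exchange[OF T(2) j(2)] by auto
    \<comment> \<open>The exchanged word is reduced for the old element and starts with
      \<open>j\<close>; cancelling this \<open>j\<close> leaves a reduced word for the new
      element.\<close>
    have "reduced_expr r \<alpha> (j # A @ B) (word_val \<alpha> S)"
      using reduced_expr_exchange T(2) AB j by blast
    then have "reduced_expr r \<alpha> ([j] @ (A @ B)) (word_val \<alpha> S)"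
      and "word_val \<alpha> S = simple_refl \<alpha> j \<circ> word_val \<alpha> (A @ B)"
      by (auto simp: reduced_expr_def)
    then have "reduced_expr r \<alpha> (A @ B) (word_val \<alpha> (j # S))"
      using reduced_expr_appendD[of r \<alpha> "[j]" "A @ B"] by simp
    then show ?thesis
      using T(1) AB(1) by (intro bexI[of _ "A @ B"]) (simp_all add: comp_def)
  qed
qed

lemma parabolic_reduced_exprE:
  assumes "I \<subseteq> {1..r}" "v \<in> parabolic \<alpha> I"
  obtains P where "P \<in> lists I" "reduced_expr r \<alpha> P v"
proof -
  obtain S where "S \<in> lists I" "v = word_val \<alpha> S"
    using assms(2) unfolding parabolic_eq by blast
  then show ?thesis
    using reduced_expr_in_parabolic[OF assms(1)] that by blast
qed

text \<open>The predicate \<open>K\<close> stands for any property of words that survives exchanges: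
  it is trivial in arguments about length and becomes \<open>witness\<close> in the theorem. The
  weak inequality in \<open>desc\<close> also admits elements known only to be of maximal
  length.\<close>

lemma reduced_prefix:
  assumes R: "reduced_expr r \<alpha> R w" "K R"
    and desc: "\<And>j. j \<in> I \<Longrightarrow> j \<in> {1..r} \<and> cox_length r \<alpha> (simple_refl \<alpha> j \<circ> w) \<le> cox_length r \<alpha> w"
    and K: "\<And>j A k B. \<lbrakk>j \<in> I; reduced_expr r \<alpha> (A @ k # B) w; word_val \<alpha> A (\<alpha> k) = \<alpha> j;
             K (A @ k # B)\<rbrakk> \<Longrightarrow> K (j # A @ B)"
    and P: "P \<in> lists I" "reduced_expr r \<alpha> P (word_val \<alpha> P)"
  shows "\<exists>Q. reduced_expr r \<alpha> (P @ Q) w \<and> K (P @ Q)"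
  using P
proof (induction P)
  case Nil
  then show ?case using R by auto
next
  case (Cons j P)
  have j: "j \<in> I" "j \<in> {1..r}" using Cons.hyps desc by auto
  have "reduced_expr r \<alpha> P (word_val \<alpha> P)"
    using reduced_expr_appendD[of r \<alpha> "[j]" P] Cons.prems by simp
  then obtain Q where Q: "reduced_expr r \<alpha> (P @ Q) w" "K (P @ Q)"
    using Cons.IH by blast
  obtain A k B where AB: "P @ Q = A @ k # B" "word_val \<alpha> A (\<alpha> k) = \<alpha> j"
    using exchange[OF Q(1) j(2)] desc[OF j(1)] by blast
  \<comment> \<open>If the deleted letter lay in \<open>P\<close>, then s_j P would have a word
    shorter than \<open>P\<close>, although \<open>j # P\<close> is reduced. Hence \<open>P\<close>
    survives intact behind the new \<open>j\<close>.\<close>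
  have "length P \<le> length A"
  proof (rule ccontr)
    assume "\<not> length P \<le> length A"
    then obtain B' where P: "P = A @ k # B'"
      using AB(1) by (auto simp: append_eq_append_conv2 append_eq_Cons_conv)
    then have "word_val \<alpha> (j # P) = word_val \<alpha> (A @ B')"
      using word_val_exchange[OF AB(2), of B'] by (metis simple_refl_comp_involution word_val_Cons)
    moreover have "cox_length r \<alpha> (word_val \<alpha> (A @ B')) \<le> length (A @ B')"
      using Cons.prems P by (intro cox_length_le) (auto simp: reduced_expr_def)
    ultimately show False
      using Cons.prems P by (simp add: reduced_expr_def)
  qed
  then obtain A' where A': "A = P @ A'"
    using AB(1) by (auto simp: append_eq_append_conv2 append_eq_Cons_conv)
  have "reduced_expr r \<alpha> (j # A @ B) w" "K (j # A @ B)"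
    using reduced_expr_exchange K Q AB j by metis+
  then show ?case
    unfolding A' by (intro exI[of _ "A' @ B"]) simp
qed

section \<open>The longest element of a parabolic subgroup\<close>

text \<open>By maximality of \<open>x\<close>, prepending a letter of \<open>I\<close> never
  lengthens it. So a reduced word of \<open>y\<close> begins some reduced word of \<open>x\<close>,
  and equal lengths leave no room for a remainder.\<close>

lemma longest_unique:
  assumes "I \<subseteq> {1..r}"
    and x: "x \<in> parabolic \<alpha> I" "\<forall>v\<in>parabolic \<alpha> I. cox_length r \<alpha> v \<le> cox_length r \<alpha> x"
    and y: "y \<in> parabolic \<alpha> I" "\<forall>v\<in>parabolic \<alpha> I. cox_length r \<alpha> v \<le> cox_length r \<alpha> y"
  shows "x = y"
proof -
  obtain S where S: "S \<in> lists I" "reduced_expr r \<alpha> S x"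
    by (rule parabolic_reduced_exprE[OF assms(1) x(1)])
  obtain T where T: "T \<in> lists I" "reduced_expr r \<alpha> T y"
    by (rule parabolic_reduced_exprE[OF assms(1) y(1)])
  have "j \<in> {1..r} \<and> cox_length r \<alpha> (simple_refl \<alpha> j \<circ> x) \<le> cox_length r \<alpha> x"
    if "j \<in> I" for j
  proof -
    have "simple_refl \<alpha> j \<circ> x = word_val \<alpha> (j # S)" "j # S \<in> lists I"
      using S that by (auto simp: reduced_expr_def)
    then have "simple_refl \<alpha> j \<circ> x \<in> parabolic \<alpha> I"
      unfolding parabolic_eq by blast
    then show ?thesis
      using x(2) that assms(1) by blast
  qed
  moreover have "reduced_expr r \<alpha> T (word_val \<alpha> T)"
    using T(2) by (simp add: reduced_expr_def)
  ultimately obtain Q where Q: "reduced_expr r \<alpha> (T @ Q) x"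
    using reduced_prefix[OF S(2), of "\<lambda>_. True" I T] T(1) by auto
  have "cox_length r \<alpha> x = cox_length r \<alpha> y"
    using x y by (meson le_antisym)
  then have "Q = []"
    using Q T(2) by (simp add: reduced_expr_def)
  then show ?thesis
    using Q T(2) by (simp add: reduced_expr_def)
qed

lemma longest_elt_eqI:
  assumes "I \<subseteq> {1..r}" "x \<in> parabolic \<alpha> I"
    and "\<forall>v\<in>parabolic \<alpha> I. cox_length r \<alpha> v \<le> cox_length r \<alpha> x"
  shows "longest_elt r \<alpha> I = x"
  unfolding longest_elt_def
proof (rule the_equality)
  show "x \<in> parabolic \<alpha> I \<and> (\<forall>v\<in>parabolic \<alpha> I. cox_length r \<alpha> v \<le> cox_length r \<alpha> x)"
    using assms by simp
  show "y = x" if "y \<in> parabolic \<alpha> I \<and> (\<forall>v\<in>parabolic \<alpha> I. cox_length r \<alpha> v \<le> cox_length r \<alpha> y)"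
    for y
    using that by (intro longest_unique[OF assms(1) _ _ assms(2,3)]) simp_all
qed

text \<open>An element with all of \<open>I\<close> among its descents bounds the lengths in the parabolic subgroup, so
  the finiteness of the latter is not needed for a longest element to exist.\<close>

lemma longest_elt:
  assumes R: "reduced_expr r \<alpha> R w" and I: "I \<subseteq> left_descents r \<alpha> w"
  shows "longest_elt r \<alpha> I \<in> parabolic \<alpha> I"
    and "\<forall>v\<in>parabolic \<alpha> I. cox_length r \<alpha> v \<le> cox_length r \<alpha> (longest_elt r \<alpha> I)"
proof -
  have sub: "I \<subseteq> {1..r}"
    using I by (auto simp: left_descents_def)
  have bound: "cox_length r \<alpha> v \<le> cox_length r \<alpha> w" if v: "v \<in> parabolic \<alpha> I" for v
  proof -
    obtain P where P: "P \<in> lists I" "reduced_expr r \<alpha> P v"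
      by (rule parabolic_reduced_exprE[OF sub v])
    moreover have "v = word_val \<alpha> P"
      using P(2) by (simp add: reduced_expr_def)
    \<comment> \<open>Every reduced word \<open>P\<close> of \<open>v\<close> with letters in
      \<open>I\<close> begins a reduced word of \<open>w\<close>, whence the bound.\<close>
    ultimately obtain Q where "reduced_expr r \<alpha> (P @ Q) w"
      using reduced_prefix[OF R, of "\<lambda>_. True" I P] I
      by (force simp: left_descents_def intro: less_imp_le)
    then show ?thesis
      using P(2) by (simp add: reduced_expr_def)
  qed
  have "word_val \<alpha> [] \<in> parabolic \<alpha> I"
    unfolding parabolic_eq by blast
  moreover have "\<forall>v. v \<in> parabolic \<alpha> I \<longrightarrow> cox_length r \<alpha> v < Suc (cox_length r \<alpha> w)"
    using bound by (simp add: less_Suc_eq_le)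
  ultimately obtain x where x: "x \<in> parabolic \<alpha> I"
      "\<forall>v\<in>parabolic \<alpha> I. cox_length r \<alpha> v \<le> cox_length r \<alpha> x"
    using ex_has_greatest_nat[of "\<lambda>v. v \<in> parabolic \<alpha> I" "word_val \<alpha> []" "cox_length r \<alpha>"
        "Suc (cox_length r \<alpha> w)"] by blast
  show "longest_elt r \<alpha> I \<in> parabolic \<alpha> I"
    and "\<forall>v\<in>parabolic \<alpha> I. cox_length r \<alpha> v \<le> cox_length r \<alpha> (longest_elt r \<alpha> I)"
    unfolding longest_elt_eqI[OF sub x] using x by simp_all
qed

text \<open>Reversing a reduced word of the inverse gives a word for the element itself.\<close>

lemma cox_length_rev_le:
  assumes "set R \<subseteq> {1..r}"
  shows "cox_length r \<alpha> (word_val \<alpha> R) \<le> cox_length r \<alpha> (word_val \<alpha> (rev R))"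
proof -
  obtain S where S: "reduced_expr r \<alpha> S (word_val \<alpha> (rev R))"
    using reduced_expr_exists[of "rev R" r \<alpha>] assms by auto
  then have "word_val \<alpha> (rev S) = word_val \<alpha> R"
    using word_val_rev_cong[of \<alpha> S "rev R"] by (simp add: reduced_expr_def)
  then show ?thesis
    using S cox_length_le[of "rev S" r \<alpha>] by (simp add: reduced_expr_def)
qed

text \<open>The inverse lies in the same parabolic subgroup and is at least as long, so it is also a
  longest element; uniqueness identifies the two.\<close>

lemma longest_elt_involution:
  assumes "reduced_expr r \<alpha> R w" "I \<subseteq> left_descents r \<alpha> w"
  shows "longest_elt r \<alpha> I \<circ> longest_elt r \<alpha> I = id"
proof -
  let ?x = "longest_elt r \<alpha> I"
  have sub: "I \<subseteq> {1..r}"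
    using assms(2) by (auto simp: left_descents_def)
  obtain S where S: "S \<in> lists I" "?x = word_val \<alpha> S"
    using longest_elt(1)[OF assms] unfolding parabolic_eq by blast
  then have "set S \<subseteq> {1..r}"
    using sub by auto
  then have "\<forall>v\<in>parabolic \<alpha> I. cox_length r \<alpha> v \<le> cox_length r \<alpha> (word_val \<alpha> (rev S))"
    using longest_elt(2)[OF assms] cox_length_rev_le S(2) le_trans by metis
  moreover have "word_val \<alpha> (rev S) \<in> parabolic \<alpha> I"
    using S(1) unfolding parabolic_eq by auto
  ultimately have "?x = word_val \<alpha> (rev S)"
    by (intro longest_elt_eqI sub)
  then have "?x \<circ> ?x = word_val \<alpha> (rev S) \<circ> word_val \<alpha> S"
    using S(2) by simp
  then show ?thesis
    by (simp add: fun_eq_iff)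
qed

section \<open>Exchanges preserve witnesses\<close>

lemma word_val_filter:
  assumes "set A \<subseteq> {1..r}" "\<And>p. p \<in> {1..r} - I \<Longrightarrow> count_list A p \<le> 1"
    and "\<And>p. p \<in> {1..r} - I \<Longrightarrow> coord p (word_val \<alpha> A v) = coord p v"
  shows "word_val \<alpha> A v = word_val \<alpha> (filter (\<lambda>i. i \<in> I) A) v"
  using assms
proof (induction A)
  case (Cons i A)
  have i: "i \<in> {1..r}" and A: "set A \<subseteq> {1..r}"
    using Cons.prems(1) by auto
  have count: "count_list A p \<le> 1" if "p \<in> {1..r} - I" for p
    using Cons.prems(2)[OF that] by (simp split: if_splits)
  have fixed: "word_val \<alpha> (i # A) v = word_val \<alpha> A v" if "i \<notin> I"
  proof -
    have "count_list A i = 0"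
      using Cons.prems(2)[of i] i that by simp
    then have "i \<notin> set A"
      by (simp add: count_list_0_iff)
    then have "coord i (word_val \<alpha> A v) = coord i v"
      by (rule coord_word_val[OF A])
    then have "coord i (simple_refl \<alpha> i (word_val \<alpha> A v)) = coord i (word_val \<alpha> A v)"
      using Cons.prems(3)[of i] i that by simp
    then have "simple_refl \<alpha> i (word_val \<alpha> A v) = word_val \<alpha> A v"
      by (rule simple_refl_fixes[OF i])
    then show ?thesis
      by simp
  qed
  \<comment> \<open>The coordinate hypothesis passes to the tail: a letter in \<open>I\<close>
    differs from \<open>p\<close> and leaves coordinate \<open>p\<close> alone, and a letter outside
    \<open>I\<close> acts trivially.\<close>
  have "coord p (word_val \<alpha> A v) = coord p v" if p: "p \<in> {1..r} - I" for p
  proof (cases "i \<in> I")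
    case True
    then have "i \<noteq> p"
      using p by blast
    then show ?thesis
      using Cons.prems(3)[OF p] coord_simple_refl[OF i] by simp
  next
    case False
    then show ?thesis
      using Cons.prems(3)[OF p] fixed by metis
  qed
  then have "word_val \<alpha> A v = word_val \<alpha> (filter (\<lambda>i. i \<in> I) A) v"
    by (intro Cons.IH A count)
  then show ?case
    using fixed by (cases "i \<in> I") simp_all
qed simp

text \<open>Reflections indexed by \<open>C\<close> subtract vectors of the span; those indexed by
  \<open>I - C\<close> have roots orthogonal to the span and fix it pointwise.\<close>

lemma word_val_span:
  assumes "A \<in> lists I" "\<forall>i\<in>I - C. \<forall>c\<in>C. \<alpha> i \<bullet> \<alpha> c = 0" "v \<in> span (\<alpha> ` C)"
  shows "word_val \<alpha> A v \<in> span (\<alpha> ` C)"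
  using assms(1)
proof (induction A)
  case Nil
  then show ?case using assms(3) by simp
next
  case (Cons i A)
  let ?u = "word_val \<alpha> A v"
  have "simple_refl \<alpha> i ?u \<in> span (\<alpha> ` C)"
  proof (cases "i \<in> C")
    case True
    then have "\<alpha> i \<in> span (\<alpha> ` C)"
      by (intro span_base imageI)
    then show ?thesis
      unfolding simple_refl_def reflection_def by (intro span_diff span_scale Cons.IH)
  next
    case False
    then have "orthogonal (\<alpha> i) y" if "y \<in> \<alpha> ` C" for y
      using Cons.hyps(1) assms(2) that unfolding orthogonal_def by blast
    then have "orthogonal (\<alpha> i) ?u"
      using Cons.IH by (rule orthogonal_to_span[rotated])
    then have "?u \<bullet> \<alpha> i = 0"
      by (metis orthogonal_def inner_commute)
    then show ?thesis
      using Cons.IH by (simp add: simple_refl_def reflection_def)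
  qed
  then show ?case by simp
qed

lemma simple_in_spanD:
  assumes "C \<subseteq> {1..r}" "j \<in> {1..r}" "\<alpha> j \<in> span (\<alpha> ` C)"
  shows "j \<in> C"
proof (rule ccontr)
  assume "j \<notin> C"
  have "coord j (\<alpha> j) = 0"
    by (rule linear_eq_0_on_span[OF linear_coord _ assms(3)])
       (use assms(1) \<open>j \<notin> C\<close> coord_simple in auto)
  then show False
    using coord_simple[OF assms(2)] by simp
qed

text \<open>If \<open>k\<close> were outside \<open>I\<close>, it could not occur in
  \<open>A\<close> as well, so coordinate \<open>k\<close> would be 1 for \<alpha>_k and still 1 for
  \<alpha>_j, which is absurd. The second part assumes only orthogonality of \<open>C\<close> to the
  rest of \<open>I\<close>, a condition that complements in \<open>I\<close> share.\<close>

lemma exchange_letter: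
  assumes "set (A @ k # B) \<subseteq> {1..r}" "\<forall>p\<in>{1..r} - I. count_list (A @ k # B) p \<le> 1"
    and "I \<subseteq> {1..r}" "j \<in> I" "word_val \<alpha> A (\<alpha> k) = \<alpha> j"
  shows "k \<in> I"
    and "\<lbrakk>C \<subseteq> I; \<forall>i\<in>I - C. \<forall>c\<in>C. \<alpha> i \<bullet> \<alpha> c = 0\<rbrakk> \<Longrightarrow> k \<in> C \<longleftrightarrow> j \<in> C"
proof -
  have k: "k \<in> {1..r}" and A: "set A \<subseteq> {1..r}" and j: "j \<in> {1..r}"
    using assms by auto
  show "k \<in> I"
  proof (rule ccontr)
    assume "k \<notin> I"
    then have "count_list A k = 0"
      using assms(2) k by force
    then have "k \<notin> set A"
      by (simp add: count_list_0_iff)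
    then have "coord k (\<alpha> j) = coord k (\<alpha> k)"
      using coord_word_val[OF A] assms(5) by metis
    moreover have "j \<noteq> k"
      using \<open>k \<notin> I\<close> assms(4) by blast
    ultimately show False
      using coord_simple[OF j, of k] coord_simple[OF k, of k] by simp
  qed
  have "count_list A p \<le> 1" if "p \<in> {1..r} - I" for p
    using bspec[OF assms(2) that] by (simp split: if_splits)
  moreover have "coord p (word_val \<alpha> A (\<alpha> k)) = coord p (\<alpha> k)" if "p \<in> {1..r} - I" for p
    using assms(4,5) \<open>k \<in> I\<close> j k that by (auto simp: coord_simple)
  ultimately have eq: "word_val \<alpha> A (\<alpha> k) = word_val \<alpha> (filter (\<lambda>i. i \<in> I) A) (\<alpha> k)"
    by (rule word_val_filter[OF A])
  \<comment> \<open>Letters of \<open>I\<close> keep \<alpha>_k inside the span of the simple roots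
    of \<open>D\<close>, and independence then puts \<open>j\<close> in \<open>D\<close>.\<close>
  have closed: "j \<in> D" if "k \<in> D" "D \<subseteq> I" "\<forall>i\<in>I - D. \<forall>c\<in>D. \<alpha> i \<bullet> \<alpha> c = 0" for D
  proof -
    have "\<alpha> j \<in> span (\<alpha> ` D)"
      unfolding assms(5)[symmetric] eq by (rule word_val_span[of _ I]) (use that in \<open>auto intro: span_base\<close>)
    then show ?thesis
      using simple_in_spanD that assms(3) j by blast
  qed
  show "k \<in> C \<longleftrightarrow> j \<in> C" if C: "C \<subseteq> I" "\<forall>i\<in>I - C. \<forall>c\<in>C. \<alpha> i \<bullet> \<alpha> c = 0"
  proof -
    \<comment> \<open>\<open>closed\<close> leads only from \<open>k\<close> to \<open>j\<close>;
      applied to the complement \<open>I - C\<close> it gives the converse.\<close>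
    have "\<forall>i\<in>I - (I - C). \<forall>c\<in>I - C. \<alpha> i \<bullet> \<alpha> c = 0"
      using C by (metis DiffD1 DiffD2 DiffI inner_commute)
    then show ?thesis
      using closed[of C] closed[of "I - C"] C \<open>k \<in> I\<close> by blast
  qed
qed

text \<open>A component is the set reachable from one vertex, and a vertex of \<open>I\<close> not
  orthogonal to a different vertex of it is adjacent to that vertex, hence reachable.\<close>

lemma dynkin_component_closed:
  assumes "I \<subseteq> {1..r}" "C \<in> dynkin_components r \<alpha> I"
  shows "C \<subseteq> I" and "\<forall>i\<in>I - C. \<forall>c\<in>C. \<alpha> i \<bullet> \<alpha> c = 0"
proof -
  let ?E = "dynkin_edges r \<alpha> \<inter> I \<times> I"
  obtain x where x: "x \<in> I" "C = ?E\<^sup>* `` {x}"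
    using assms(2) unfolding dynkin_components_def by (auto elim: quotientE)
  have "y \<in> I" if "(x, y) \<in> ?E\<^sup>*" for y
    using that x(1) by (induction rule: rtrancl_induct) auto
  then show sub: "C \<subseteq> I"
    using x(2) by auto
  show "\<forall>i\<in>I - C. \<forall>c\<in>C. \<alpha> i \<bullet> \<alpha> c = 0"
  proof (intro ballI, rule ccontr)
    fix i c assume ic: "i \<in> I - C" "c \<in> C" "\<alpha> i \<bullet> \<alpha> c \<noteq> 0"
    then have "(c, i) \<in> ?E"
      using sub assms(1) by (auto simp: dynkin_edges_def inner_commute)
    then have "i \<in> C"
      using ic(2) x(2) by (auto intro: rtrancl_into_rtrancl)
    then show False using ic(1) by simp
  qed
qed

text \<open>The letters \<open>k\<close> and \<open>j\<close> both lie in \<open>I\<close>, and in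
  the same component, so the trade can raise no count outside \<open>I\<close> and changes no count
  over a component.\<close>

lemma witness_exchange:
  assumes W: "witness r \<alpha> I w (A @ k # B)" and I: "I \<subseteq> {1..r}" "j \<in> I"
    and AB: "word_val \<alpha> A (\<alpha> k) = \<alpha> j"
  shows "witness r \<alpha> I w (j # A @ B)"
proof -
  have red: "reduced_expr r \<alpha> (A @ k # B) w"
    and count: "\<forall>p\<in>{1..r} - I. count_list (A @ k # B) p \<le> 1"
    and comp: "\<forall>C\<in>dynkin_components r \<alpha> I. length (filter (\<lambda>i. i \<in> C) (A @ k # B))
        \<le> cox_length r \<alpha> (longest_elt r \<alpha> C) + card C"
    using W by (simp_all add: witness_def)
  have sub: "set (A @ k # B) \<subseteq> {1..r}"
    using red by (simp add: reduced_expr_def)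
  have "reduced_expr r \<alpha> (j # A @ B) w"
    using reduced_expr_exchange red AB I by blast
  moreover have "\<forall>p\<in>{1..r} - I. count_list (j # A @ B) p \<le> 1"
  proof
    fix p assume p: "p \<in> {1..r} - I"
    then have "p \<noteq> j" "p \<noteq> k"
      using I(2) exchange_letter(1)[OF sub count I AB] by auto
    then show "count_list (j # A @ B) p \<le> 1"
      using bspec[OF count p] by simp
  qed
  moreover have "\<forall>C\<in>dynkin_components r \<alpha> I. length (filter (\<lambda>i. i \<in> C) (j # A @ B))
        \<le> cox_length r \<alpha> (longest_elt r \<alpha> C) + card C"
  proof
    fix C assume C: "C \<in> dynkin_components r \<alpha> I"
    have "k \<in> C \<longleftrightarrow> j \<in> C"
      using exchange_letter(2)[OF sub count I AB] dynkin_component_closed[OF I(1) C] by blast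
    then have "length (filter (\<lambda>i. i \<in> C) (j # A @ B)) = length (filter (\<lambda>i. i \<in> C) (A @ k # B))"
      by simp
    then show "length (filter (\<lambda>i. i \<in> C) (j # A @ B))
        \<le> cox_length r \<alpha> (longest_elt r \<alpha> C) + card C"
      using comp C by metis
  qed
  ultimately show ?thesis
    by (simp only: witness_def)
qed

end

theorem proposition2p6:
  fixes \<Phi> :: "'a::euclidean_space set" and r :: nat and \<alpha> :: "nat \<Rightarrow> 'a"
    and w :: "'a \<Rightarrow> 'a" and I :: "nat set"
  assumes "crystallographic_root_system \<Phi>"
    and "simple_system \<Phi> r \<alpha>"
    and "w \<in> weyl_group \<Phi>"
    and "I \<subseteq> left_descents r \<alpha> w"
    and "spherical r \<alpha> I w"
  shows "\<exists>R' R''. witness r \<alpha> I w (R' @ R'') \<and>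
           reduced_expr r \<alpha> R' (longest_elt r \<alpha> I) \<and>
           reduced_expr r \<alpha> R'' (longest_elt r \<alpha> I \<circ> w)"
proof -
  interpret root_basis \<Phi> r \<alpha>
    using assms by unfold_locales
  let ?x = "longest_elt r \<alpha> I"
  have sub: "I \<subseteq> {1..r}"
    using assms(4) by (auto simp: left_descents_def)
  obtain R where R: "witness r \<alpha> I w R" "reduced_expr r \<alpha> R w"
    using assms(5) by (auto simp: spherical_def witness_def)
  \<comment> \<open>The word \<open>P\<close> becomes the first factor; its letters lie in
    \<open>I\<close>, as prepending by exchanges requires.\<close>
  obtain P where P: "P \<in> lists I" "reduced_expr r \<alpha> P ?x"
    by (rule parabolic_reduced_exprE[OF sub longest_elt(1)[OF R(2) assms(4)]])
  have x: "?x = word_val \<alpha> P"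
    using P(2) by (simp add: reduced_expr_def)
  have "\<exists>Q. reduced_expr r \<alpha> (P @ Q) w \<and> witness r \<alpha> I w (P @ Q)"
  proof (rule reduced_prefix[where K = "witness r \<alpha> I w" and I = I and R = R])
    show "j \<in> {1..r} \<and> cox_length r \<alpha> (simple_refl \<alpha> j \<circ> w) \<le> cox_length r \<alpha> w"
      if "j \<in> I" for j
      using that assms(4) by (auto simp: left_descents_def)
    show "witness r \<alpha> I w (j # A @ B)"
      if "j \<in> I" "word_val \<alpha> A (\<alpha> k) = \<alpha> j" "witness r \<alpha> I w (A @ k # B)" for j A k B
      using witness_exchange that sub by blast
  qed (use R P x in simp_all)
  then obtain Q where Q: "reduced_expr r \<alpha> (P @ Q) w" "witness r \<alpha> I w (P @ Q)"
    by blast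
  \<comment> \<open>Here \<open>w\<close> is \<open>?x\<close> followed on the right by the value of
    \<open>Q\<close>, so the involution property cancels the two copies of
    \<open>?x\<close>.\<close>
  have "?x \<circ> w = (?x \<circ> ?x) \<circ> word_val \<alpha> Q"
    using Q(1) x by (auto simp: reduced_expr_def)
  then have "?x \<circ> w = word_val \<alpha> Q"
    using longest_elt_involution[OF R(2) assms(4)] by simp
  then have "reduced_expr r \<alpha> Q (?x \<circ> w)"
    using reduced_expr_appendD[OF Q(1)] by simp
  then show ?thesis
    using P(2) Q(2) by blast
qed

end
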